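(* For any $J\subset[d]$, $$\partial_{y_i}g_J=\begin{cases}\mu_i^J g_J+\sum_{j\in J}\sigma_{ij}^J\, g_{J\setminus\{j\}} & i\in J,\\ 0 & i\notin J,\end{cases}\qquad(1\le i\le d),$$ $$\partial_{x_{ij}}g_J=\begin{cases}2\partial_{y_i}\partial_{y_j}g_J & \{i,j\}\subset J,\ i<j,\\ \partial_{y_i}^2 g_J & \{i\}\subset J,\ i=j,\\ 0 & \text{otherwise,}\end{cases}\qquad(1\le i\le j\le d).$$
   Context: $[d]=\{1,\dots,d\}$. Let $x=(x_{ij})$ be a real symmetric $d\times d$ matrix with $-x$ positive definite and $y\in\mathbf{R}^d$; the coordinates on symmetric matrices are $x_{ij}$ with $i\le j$, and $x_{ij}=x_{ji}$; $\partial_z=\partial/\partial z$. For $J\subset[d]$, $h_J(x,y,t)=\sum_{i\in J}\sum_{j\in J}x_{ij}t_it_j+\sum_{k\in J}y_kt_k$ and $g_J(x,y)=\int_0^\infty\cdots\int_0^\infty\exp(h_J(x,y,t))\,dt_J$ with $dt_J=\prod_{j\in J}dt_j$; $g_\emptyset=1$. For $J=\{j_1<\dots<j_s\}$, $x_J=(x_{j_kj_\ell})_{1\le k,\ell\le s}$, $y_J=(y_{j_1},\dots,y_{j_s})^T$, $\Sigma_J=-\frac12 x_J^{-1}=(\sigma_{ij}^J)_{i,j\in J}$ and $\mu_J=\Sigma_Jy_J=(\mu_i^J)_{i\in J}$, with rows and columns indexed by the elements of $J$. *)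

theory Defs
  imports
    "HOL-Analysis.Analysis"
    "Jordan_Normal_Form.DL_Submatrix"
    "Jordan_Normal_Form.Gauss_Jordan_Elimination"
begin

unbundle no vec_syntax
unbundle no inner_syntax

(* Matrices and vectors are those of Jordan_Normal_Form, whose indices start at 0:
   [d] is the index set {..<d}. *)

definition positive_definite_mat :: "real mat \<Rightarrow> bool" where
  "positive_definite_mat A \<longleftrightarrow> square_mat A \<and>
     (\<forall>v \<in> carrier_vec (dim_row A). v \<noteq> 0\<^sub>v (dim_row A) \<longrightarrow> 0 < v \<bullet> (A *\<^sub>v v))"

definition hJ :: "nat set \<Rightarrow> real mat \<Rightarrow> real vec \<Rightarrow> (nat \<Rightarrow> real) \<Rightarrow> real" where
  "hJ J x y t = (\<Sum>i\<in>J. \<Sum>j\<in>J. x $$ (i, j) * t i * t j) + (\<Sum>k\<in>J. y $ k * t k)"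

(* For J = {} the product measure is the unit point mass, so gJ {} x y = 1. *)
definition gJ :: "nat set \<Rightarrow> real mat \<Rightarrow> real vec \<Rightarrow> real" where
  "gJ J x y = (LINT t : (\<Pi>\<^sub>E j\<in>J. {0..}) | (\<Pi>\<^sub>M j\<in>J. lborel). exp (hJ J x y t))"

definition SigmaJ :: "nat set \<Rightarrow> real mat \<Rightarrow> real mat" where
  "SigmaJ J x = (- 1 / 2) \<cdot>\<^sub>m the (mat_inverse (submatrix x J J))"

definition subvec :: "real vec \<Rightarrow> nat set \<Rightarrow> real vec" where
  "subvec y J = vec (card J) (\<lambda>k. y $ pick J k)"

definition muJ :: "nat set \<Rightarrow> real mat \<Rightarrow> real vec \<Rightarrow> real vec" where
  "muJ J x y = SigmaJ J x *\<^sub>v subvec y J"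

(* The inverse of pick J: it translates an element of J into the row or column
   number that this element has in submatrix x J J. *)
definition posn :: "nat set \<Rightarrow> nat \<Rightarrow> nat" where
  "posn J i = card {a \<in> J. a < i}"

definition sigma_entry :: "nat set \<Rightarrow> real mat \<Rightarrow> nat \<Rightarrow> nat \<Rightarrow> real" where
  "sigma_entry J x i j = SigmaJ J x $$ (posn J i, posn J j)"

definition mu_entry :: "nat set \<Rightarrow> real mat \<Rightarrow> real vec \<Rightarrow> nat \<Rightarrow> real" where
  "mu_entry J x y i = muJ J x y $ posn J i"

definition along_y :: "(real mat \<Rightarrow> real vec \<Rightarrow> real) \<Rightarrow> nat \<Rightarrow> real mat \<Rightarrow> real vec \<Rightarrow> real \<Rightarrow> real" where
  "along_y F i x y = (\<lambda>s. F x (y |\<^sub>v i \<mapsto> s))"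

(* The coordinates of a symmetric matrix are its entries on and above the diagonal,
   so the entries (i, j) and (j, i) move together. *)
definition along_x :: "(real mat \<Rightarrow> real vec \<Rightarrow> real) \<Rightarrow> nat \<Rightarrow> nat \<Rightarrow> real mat \<Rightarrow> real vec \<Rightarrow> real \<Rightarrow> real" where
  "along_x F i j x y = (\<lambda>s. F ((x |\<^sub>m (i, j) \<mapsto> s) |\<^sub>m (j, i) \<mapsto> s) y)"

definition has_partial_y ::
  "(real mat \<Rightarrow> real vec \<Rightarrow> real) \<Rightarrow> nat \<Rightarrow> real mat \<Rightarrow> real vec \<Rightarrow> real \<Rightarrow> bool" where
  "has_partial_y F i x y D \<longleftrightarrow> (along_y F i x y has_real_derivative D) (at (y $ i))"

definition has_partial_x ::
  "(real mat \<Rightarrow> real vec \<Rightarrow> real) \<Rightarrow> nat \<Rightarrow> nat \<Rightarrow> real mat \<Rightarrow> real vec \<Rightarrow> real \<Rightarrow> bool" where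
  "has_partial_x F i j x y D \<longleftrightarrow> (along_x F i j x y has_real_derivative D) (at (x $$ (i, j)))"

definition partial_y ::
  "nat \<Rightarrow> (real mat \<Rightarrow> real vec \<Rightarrow> real) \<Rightarrow> real mat \<Rightarrow> real vec \<Rightarrow> real" where
  "partial_y i F x y = deriv (along_y F i x y) (y $ i)"

end

theory Submission
  imports Defs "HOL-Probability.Distributions" "HOL-Real_Asymp.Real_Asymp"
    "Jordan_Normal_Form.Determinant"
begin

text \<open>
  Negative definiteness gives \<open>h\<^sub>J(t) \<le> C - c |t|\<^sup>2\<close> with \<open>c > 0\<close>. Along each coordinate the
  integrand is an exponential family \<open>w(t) exp(s b(t))\<close> with \<open>b\<close> at most quadratic in \<open>t\<close>, so
  it can be differentiated under the integral sign: \<open>y\<^sub>i\<close> brings down \<open>t\<^sub>i\<close>, and \<open>x\<^sub>i\<^sub>j\<close> brings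
  down \<open>2 t\<^sub>i t\<^sub>j\<close> (or \<open>t\<^sub>i\<^sup>2\<close>), which gives the second formula. For the first, integrating
  \<open>\<partial>/\<partial>t\<^sub>j exp h\<^sub>J\<close> over the orthant leaves only the face \<open>t\<^sub>j = 0\<close>, which says
  \<open>2 x\<^sub>J E + g\<^sub>J y\<^sub>J = - G\<close> for the vectors \<open>G\<^sub>j = g\<close> at \<open>J \ {j}\<close> and \<open>E\<^sub>i = \<partial>g\<^sub>J/\<partial>y\<^sub>i\<close>; multiplying by
  \<open>\<Sigma>\<^sub>J\<close> solves for \<open>E\<close>.
\<close>

unbundle no vec_syntax
unbundle no inner_syntax

subsection \<open>Gaussian domination and differentiation under the integral sign\<close>

definition sqn :: "nat set \<Rightarrow> (nat \<Rightarrow> real) \<Rightarrow> real" where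
  "sqn J t = (\<Sum>j\<in>J. (t j)\<^sup>2)"

text \<open>Only some rate \<open>c\<close> is asked for, so a growing factor can be absorbed by
  giving up part of the decay.\<close>

definition dominated :: "nat set \<Rightarrow> ((nat \<Rightarrow> real) \<Rightarrow> real) \<Rightarrow> bool" where
  "dominated J w \<longleftrightarrow> w \<in> borel_measurable (\<Pi>\<^sub>M j\<in>J. lborel) \<and>
     (\<exists>c>0. \<exists>K. \<forall>t. \<bar>w t\<bar> \<le> K * exp (- c * sqn J t))"

abbreviation orthant_int :: "nat set \<Rightarrow> ((nat \<Rightarrow> real) \<Rightarrow> real) \<Rightarrow> real" where
  "orthant_int J w \<equiv> (LINT t : (\<Pi>\<^sub>E j\<in>J. {0..}) | (\<Pi>\<^sub>M j\<in>J. lborel). w t)"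

interpretation lb: product_sigma_finite "\<lambda>_::nat. lborel :: real measure"
  by standard

lemma borel_measurable_exp_comp:
  fixes f :: "'a \<Rightarrow> real"
  shows "f \<in> borel_measurable M \<Longrightarrow> (\<lambda>x. exp (f x)) \<in> borel_measurable M"
  by measurable

lemmas borel_intros = borel_measurable_times borel_measurable_add borel_measurable_diff
  borel_measurable_abs borel_measurable_exp_comp borel_measurable_const

lemma sqn_nonneg: "0 \<le> sqn J t"
  by (simp add: sqn_def sum_nonneg)

lemma orthant_sets:
  assumes "finite J"
  shows "(\<Pi>\<^sub>E j\<in>J. {0::real..}) \<in> sets (\<Pi>\<^sub>M j\<in>J. lborel)"
  using assms by (intro sets_PiM_I_finite) auto

text \<open>Up to a constant this is the centred normal density of variance
  \<open>1 / (2 * c)\<close>; \<open>s\<close> is its standard deviation.\<close>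

lemma integrable_gauss:
  assumes "(c::real) > 0"
  shows "integrable lborel (\<lambda>t::real. exp (- c * t\<^sup>2))"
proof -
  define s where "s = 1 / sqrt (2 * c)"
  have s: "s > 0" "2 * s\<^sup>2 = 1 / c" using assms by (auto simp: s_def power_divide)
  have "integrable lborel (\<lambda>t. sqrt (2 * pi * s\<^sup>2) * normal_density 0 s t)"
    using s by (intro integrable_mult_right) auto
  moreover have "sqrt (2 * pi * s\<^sup>2) * normal_density 0 s t = exp (- c * t\<^sup>2)" for t
    unfolding normal_density_def using s(1) assms by (simp add: s(2))
  ultimately show ?thesis by simp
qed

text \<open>The exponential of a sum of squares factors into one-dimensional Gaussians, each
  integrable.\<close>

lemma integrable_exp_sqn:
  assumes "finite J" "c > 0"
  shows "integrable (\<Pi>\<^sub>M j\<in>J. lborel) (\<lambda>t. exp (- c * sqn J t))"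
proof -
  have "integrable (\<Pi>\<^sub>M j\<in>J. lborel) (\<lambda>t. \<Prod>j\<in>J. exp (- c * (t j)\<^sup>2))"
    using assms by (intro lb.product_integrable_prod integrable_gauss) auto
  thus ?thesis
    using assms by (simp add: sqn_def exp_sum sum_distrib_left flip: sum_negf)
qed

lemma dominatedE:
  assumes "dominated J w"
  obtains c K where "c > 0" "K \<ge> 0" "\<And>t. \<bar>w t\<bar> \<le> K * exp (- c * sqn J t)"
proof -
  obtain c K where *: "c > 0" "\<And>t. \<bar>w t\<bar> \<le> K * exp (- c * sqn J t)"
    using assms unfolding dominated_def by auto
  \<comment> \<open>The bound holds everywhere, so evaluating it at any single point yields the sign
    of \<open>K\<close>.\<close>
  have "0 \<le> \<bar>w undefined\<bar>" by simp
  also have "\<dots> \<le> K * exp (- c * sqn J undefined)" by (rule *)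
  finally have "K \<ge> 0" by (simp add: zero_le_mult_iff)
  with * that show ?thesis by blast
qed

lemma dominated_integrable:
  assumes "finite J" "dominated J w"
  shows "integrable (\<Pi>\<^sub>M j\<in>J. lborel) w"
proof -
  obtain c K where *: "c > 0" "\<And>t. \<bar>w t\<bar> \<le> K * exp (- c * sqn J t)"
    using assms unfolding dominated_def by auto
  show ?thesis
    by (rule Bochner_Integration.integrable_bound[OF integrable_mult_right[OF integrable_exp_sqn[OF assms(1) *(1)], of K]])
      (use assms * in \<open>auto simp: dominated_def intro: order_trans[OF _ abs_ge_self]\<close>)
qed

lemma dominated_set_integrable:
  assumes "finite J" "dominated J w" "A \<in> sets (\<Pi>\<^sub>M j\<in>J. lborel)"
  shows "set_integrable (\<Pi>\<^sub>M j\<in>J. lborel) A w"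
  using integrable_mult_indicator[OF assms(3) dominated_integrable[OF assms(1,2)]]
  by (simp add: set_integrable_def)

lemma dominated_add:
  assumes "dominated J v" "dominated J w"
  shows "dominated J (\<lambda>t. v t + w t)"
proof -
  obtain c K where 1: "c > 0" "K \<ge> 0" "\<And>t. \<bar>v t\<bar> \<le> K * exp (- c * sqn J t)"
    using dominatedE[OF assms(1)] by blast
  obtain c' K' where 2: "c' > 0" "K' \<ge> 0" "\<And>t. \<bar>w t\<bar> \<le> K' * exp (- c' * sqn J t)"
    using dominatedE[OF assms(2)] by blast
  \<comment> \<open>The slower of the two rates serves both summands.\<close>
  have "\<bar>v t + w t\<bar> \<le> (K + K') * exp (- min c c' * sqn J t)" for t
  proof -
    have "K * exp (- c * sqn J t) \<le> K * exp (- min c c' * sqn J t)"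
         "K' * exp (- c' * sqn J t) \<le> K' * exp (- min c c' * sqn J t)"
      using 1 2 by (auto intro!: mult_left_mono mult_right_mono simp: sqn_nonneg)
    with 1(3)[of t] 2(3)[of t] show ?thesis by (simp add: algebra_simps)
  qed
  moreover have "min c c' > 0" using 1 2 by simp
  moreover have "(\<lambda>t. v t + w t) \<in> borel_measurable (\<Pi>\<^sub>M j\<in>J. lborel)"
    using assms by (auto simp: dominated_def intro: borel_intros)
  ultimately show ?thesis unfolding dominated_def by blast
qed

text \<open>Half of the Gaussian decay pays for the exponential, which in turn is what
  dominates every polynomial factor.\<close>

lemma dominated_mult_exp:
  assumes "dominated J w" "b \<in> borel_measurable (\<Pi>\<^sub>M j\<in>J. lborel)"
    and "\<And>t. \<bar>b t\<bar> \<le> L * (1 + sqn J t)"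
  obtains e where "e > 0" "dominated J (\<lambda>t. w t * exp (e * \<bar>b t\<bar>))"
proof -
  obtain c K where 1: "c > 0" "K \<ge> 0" "\<And>t. \<bar>w t\<bar> \<le> K * exp (- c * sqn J t)"
    using dominatedE[OF assms(1)] by blast
  \<comment> \<open>The maximum with 1 keeps the divisor in \<open>e\<close> positive whatever
    \<open>L\<close> is.\<close>
  define M where "M = max L 1"
  have M: "M > 0" "\<bar>b t\<bar> \<le> M * (1 + sqn J t)" for t
    using order_trans[OF assms(3)[of t], of "M * (1 + sqn J t)"] sqn_nonneg[of J t]
    by (auto simp: M_def intro: mult_right_mono)
  define e where "e = c / (2 * M)"
  have e: "e > 0" "e * M = c / 2" using 1 M by (auto simp: e_def)
  have "\<bar>w t * exp (e * \<bar>b t\<bar>)\<bar> \<le> (K * exp (c / 2)) * exp (- (c / 2) * sqn J t)" for t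
  proof -
    have "e * \<bar>b t\<bar> \<le> e * (M * (1 + sqn J t))" using e M by (intro mult_left_mono) auto
    also have "\<dots> = c / 2 * (1 + sqn J t)" by (simp only: e(2) flip: mult.assoc)
    finally have "exp (e * \<bar>b t\<bar>) \<le> exp (c / 2 * (1 + sqn J t))" by simp
    with 1(3)[of t] 1(2) have "\<bar>w t\<bar> * exp (e * \<bar>b t\<bar>) \<le>
        (K * exp (- c * sqn J t)) * exp (c / 2 * (1 + sqn J t))"
      by (intro mult_mono) auto
    also have "\<dots> = (K * exp (c / 2)) * exp (- (c / 2) * sqn J t)"
      by (simp add: field_simps flip: exp_add)
    finally show ?thesis by (simp add: abs_mult)
  qed
  moreover have "c / 2 > 0" using 1 by simp
  moreover have "(\<lambda>t. w t * exp (e * \<bar>b t\<bar>)) \<in> borel_measurable (\<Pi>\<^sub>M j\<in>J. lborel)"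
    using assms(1,2) by (auto simp: dominated_def intro!: borel_intros)
  ultimately have "dominated J (\<lambda>t. w t * exp (e * \<bar>b t\<bar>))"
    unfolding dominated_def by blast
  with e that show ?thesis by blast
qed

lemma dominated_mono:
  assumes "dominated J w" "v \<in> borel_measurable (\<Pi>\<^sub>M j\<in>J. lborel)" "\<And>t. \<bar>v t\<bar> \<le> C * \<bar>w t\<bar>"
  shows "dominated J v"
proof -
  obtain c K where 1: "c > 0" "K \<ge> 0" "\<And>t. \<bar>w t\<bar> \<le> K * exp (- c * sqn J t)"
    using dominatedE[OF assms(1)] by blast
  have "\<bar>v t\<bar> \<le> (max C 0 * K) * exp (- c * sqn J t)" for t
  proof -
    have "\<bar>v t\<bar> \<le> C * \<bar>w t\<bar>" by (rule assms)
    also have "\<dots> \<le> max C 0 * \<bar>w t\<bar>" by (intro mult_right_mono) auto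
    also have "\<dots> \<le> max C 0 * (K * exp (- c * sqn J t))" by (intro mult_left_mono 1) auto
    finally show ?thesis by simp
  qed
  with 1(1) assms(2) show ?thesis unfolding dominated_def by blast
qed

text \<open>Since \<open>u \<le> exp u\<close>, the factor \<open>b\<close> is at most
  \<open>1 / e\<close> times \<open>exp (e * \<bar>b t\<bar>)\<close>, whose product with
  \<open>w\<close> is dominated for a suitable \<open>e\<close>.\<close>

lemma dominated_mult:
  assumes "dominated J w" "b \<in> borel_measurable (\<Pi>\<^sub>M j\<in>J. lborel)"
    and "\<And>t. \<bar>b t\<bar> \<le> L * (1 + sqn J t)"
  shows "dominated J (\<lambda>t. w t * b t)"
proof -
  obtain e where e: "e > 0" "dominated J (\<lambda>t. w t * exp (e * \<bar>b t\<bar>))"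
    using dominated_mult_exp[OF assms] by blast
  show ?thesis
  proof (rule dominated_mono[OF e(2)])
    show "(\<lambda>t. w t * b t) \<in> borel_measurable (\<Pi>\<^sub>M j\<in>J. lborel)"
      using assms(1,2) by (auto simp: dominated_def intro!: borel_intros)
    fix t
    have "e * \<bar>b t\<bar> \<le> exp (e * \<bar>b t\<bar>)" using exp_ge_add_one_self[of "e * \<bar>b t\<bar>"] by linarith
    hence "\<bar>b t\<bar> \<le> (1 / e) * exp (e * \<bar>b t\<bar>)" using e(1) by (simp add: field_simps)
    thus "\<bar>w t * b t\<bar> \<le> (1 / e) * \<bar>w t * exp (e * \<bar>b t\<bar>)\<bar>"
      by (simp add: abs_mult) (metis abs_ge_zero mult.left_commute mult_left_mono times_divide_eq_right mult_1_right)
  qed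
qed

text \<open>Lagrange form of the remainder: it equals \<open>exp t / 2 * u\<^sup>2\<close> with
  \<open>\<bar>t\<bar> \<le> \<bar>u\<bar>\<close>, and the factor 1/2 is given away.\<close>

lemma exp_minus_linear_bound:
  fixes u :: real
  shows "\<bar>exp u - 1 - u\<bar> \<le> u\<^sup>2 * exp \<bar>u\<bar>"
proof (cases "u = 0")
  case False
  then obtain t where t: "\<bar>t\<bar> \<le> \<bar>u\<bar>" "exp u = (\<Sum>m<2. u ^ m / fact m) + exp t / fact 2 * u ^ 2"
    using Maclaurin_exp_le[of u 2] by blast
  hence "\<bar>exp u - 1 - u\<bar> = exp t / 2 * u\<^sup>2" by (simp add: numeral_2_eq_2)
  also have "\<dots> \<le> exp \<bar>u\<bar> * u\<^sup>2"
  proof (intro mult_right_mono)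
    have "exp t \<le> exp \<bar>u\<bar>" using t by simp
    thus "exp t / 2 \<le> exp \<bar>u\<bar>" by (smt (verit) exp_gt_zero field_sum_of_halves)
  qed auto
  finally show ?thesis by (simp add: mult.commute)
qed simp

text \<open>The second-order Taylor bound of the exponential replaces dominated convergence.\<close>

lemma orthant_int_has_derivative:
  assumes J: "finite J" and w: "dominated J w" and b: "b \<in> borel_measurable (\<Pi>\<^sub>M j\<in>J. lborel)"
    and bd: "\<And>t. \<bar>b t\<bar> \<le> L * (1 + sqn J t)"
  shows "((\<lambda>s. orthant_int J (\<lambda>t. w t * exp ((s - s0) * b t)))
           has_real_derivative orthant_int J (\<lambda>t. w t * b t)) (at s0)"
proof -
  let ?M = "\<Pi>\<^sub>M j\<in>J. (lborel :: real measure)"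
  let ?P = "\<Pi>\<^sub>E j\<in>J. {0::real..}"
  let ?F = "\<lambda>s. orthant_int J (\<lambda>t. w t * exp ((s - s0) * b t))"
  let ?D = "orthant_int J (\<lambda>t. w t * b t)"
  have wm: "w \<in> borel_measurable ?M" using w by (simp add: dominated_def)
  obtain e where e: "e > 0" "dominated J (\<lambda>t. w t * exp (e * \<bar>b t\<bar>))"
    using dominated_mult_exp[OF w b bd] by blast
  have int: "set_integrable ?M ?P v" if "dominated J v" for v
    using dominated_set_integrable[OF J that orthant_sets[OF J]] .
  \<comment> \<open>\<open>(s - s0)\<^sup>2 * R t\<close> majorises the Taylor remainder for every
    \<open>s\<close> within \<open>e\<close> of \<open>s0\<close>. The two factors \<open>b\<close>
    cost only part of the Gaussian decay, so \<open>R\<close> is integrable.\<close>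
  define R where "R = (\<lambda>t. \<bar>w t * exp (e * \<bar>b t\<bar>) * b t * b t\<bar>)"
  have R: "dominated J R" unfolding R_def
    by (rule dominated_mono[where C=1, OF dominated_mult[OF dominated_mult[OF e(2) b bd] b bd]])
      (auto intro!: borel_intros wm b)
  have est: "\<bar>?F s - ?F s0 - (s - s0) * ?D\<bar> \<le> (s - s0)\<^sup>2 * orthant_int J R" if s: "\<bar>s - s0\<bar> \<le> e" for s
  proof -
    define h where "h = s - s0"
    have le: "exp \<bar>h * b t\<bar> \<le> exp (e * \<bar>b t\<bar>)" for t
      using s by (simp add: h_def abs_mult mult_right_mono)
    have d1: "dominated J (\<lambda>t. w t * exp (h * b t))"
    proof (rule dominated_mono[where C=1, OF e(2)])
      fix t
      have "exp (h * b t) \<le> exp (e * \<bar>b t\<bar>)" using le[of t]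
        by (smt (verit) exp_le_cancel_iff)
      thus "\<bar>w t * exp (h * b t)\<bar> \<le> 1 * \<bar>w t * exp (e * \<bar>b t\<bar>)\<bar>"
        by (simp add: abs_mult mult_left_mono)
    qed (intro borel_intros wm b)
    note d2 = dominated_mult[OF w b bd]
    have d3: "dominated J (\<lambda>t. w t * (exp (h * b t) - 1 - h * b t))"
    proof -
      have "dominated J (\<lambda>t. w t * exp (h * b t) + ((- 1) * w t + (- h) * (w t * b t)))"
        by (intro dominated_add d1 dominated_mono[OF w, of _ 1] dominated_mono[OF d2, of _ "\<bar>h\<bar>"])
          (auto simp: abs_mult intro!: borel_intros wm b)
      thus ?thesis by (simp add: algebra_simps)
    qed
    have "?F s - ?F s0 - h * ?D = orthant_int J (\<lambda>t. w t * (exp (h * b t) - 1 - h * b t))"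
      using int[OF d1] int[OF d2] int[OF w]
      by (simp add: h_def[symmetric] right_diff_distrib set_integral_diff mult.left_commute[of _ h])
    also have "\<bar>\<dots>\<bar> \<le> orthant_int J (\<lambda>t. \<bar>w t * (exp (h * b t) - 1 - h * b t)\<bar>)"
      using set_integral_norm_bound[OF int[OF d3]] by simp
    also have "\<dots> \<le> orthant_int J (\<lambda>t. h\<^sup>2 * R t)"
    proof (rule set_integral_mono)
      show "set_integrable ?M ?P (\<lambda>t. \<bar>w t * (exp (h * b t) - 1 - h * b t)\<bar>)"
        using set_integrable_norm[OF int[OF d3]] by simp
      show "set_integrable ?M ?P (\<lambda>t. h\<^sup>2 * R t)" using int[OF R] by simp
      fix t
      have "\<bar>exp (h * b t) - 1 - h * b t\<bar> \<le> (h * b t)\<^sup>2 * exp \<bar>h * b t\<bar>" by (rule exp_minus_linear_bound)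
      also have "\<dots> \<le> (h * b t)\<^sup>2 * exp (e * \<bar>b t\<bar>)" by (intro mult_left_mono le) auto
      finally have "\<bar>w t\<bar> * \<bar>exp (h * b t) - 1 - h * b t\<bar> \<le> \<bar>w t\<bar> * ((h * b t)\<^sup>2 * exp (e * \<bar>b t\<bar>))"
        by (intro mult_left_mono) auto
      also have "\<dots> = h\<^sup>2 * R t" by (simp add: R_def abs_mult power2_eq_square)
      finally show "\<bar>w t * (exp (h * b t) - 1 - h * b t)\<bar> \<le> h\<^sup>2 * R t" by (simp add: abs_mult)
    qed
    finally show ?thesis by (simp add: h_def)
  qed
  define I where "I = orthant_int J R"
  \<comment> \<open>The error is quadratic in \<open>s - s0\<close>, so the difference quotient
    misses \<open>?D\<close> by at most a linear term.\<close>
  have "(\<lambda>s. (?F s - ?F s0) / (s - s0) - ?D) \<midarrow>s0\<rightarrow> 0"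
  proof (rule tendsto_rabs_zero_cancel, rule tendsto_sandwich)
    show "\<forall>\<^sub>F s in at s0. 0 \<le> \<bar>(?F s - ?F s0) / (s - s0) - ?D\<bar>" by simp
    show "\<forall>\<^sub>F s in at s0. \<bar>(?F s - ?F s0) / (s - s0) - ?D\<bar> \<le> \<bar>s - s0\<bar> * I"
      unfolding eventually_at
    proof (intro exI[of _ e] conjI ballI impI)
      fix s assume s: "s \<noteq> s0 \<and> dist s s0 < e"
      hence "\<bar>?F s - ?F s0 - (s - s0) * ?D\<bar> \<le> (s - s0)\<^sup>2 * I"
        unfolding I_def by (intro est) (auto simp: dist_real_def)
      hence "\<bar>?F s - ?F s0 - (s - s0) * ?D\<bar> / \<bar>s - s0\<bar> \<le> (s - s0)\<^sup>2 * I / \<bar>s - s0\<bar>"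
        by (intro divide_right_mono) auto
      also have "\<dots> = \<bar>s - s0\<bar> * I"
        using s by (simp add: field_simps power2_eq_square flip: abs_mult)
      also have "\<bar>?F s - ?F s0 - (s - s0) * ?D\<bar> / \<bar>s - s0\<bar> = \<bar>(?F s - ?F s0) / (s - s0) - ?D\<bar>"
        using s by (simp add: diff_divide_distrib flip: abs_divide)
      finally show "\<bar>(?F s - ?F s0) / (s - s0) - ?D\<bar> \<le> \<bar>s - s0\<bar> * I" .
    qed (fact e(1))
    show "(\<lambda>s. \<bar>s - s0\<bar> * I) \<midarrow>s0\<rightarrow> 0"
      by (auto intro!: tendsto_eq_intros)
  qed auto
  hence "(\<lambda>s. (?F s - ?F s0) / (s - s0)) \<midarrow>s0\<rightarrow> ?D"
    using Lim_null by blast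
  thus ?thesis by (simp add: has_field_derivative_iff)
qed

subsection \<open>Integration by parts\<close>

definition quad :: "nat set \<Rightarrow> real mat \<Rightarrow> (nat \<Rightarrow> real) \<Rightarrow> real" where
  "quad J x t = (\<Sum>i\<in>J. \<Sum>j\<in>J. x $$ (i, j) * t i * t j)"

text \<open>Negative definiteness of the form on \<open>J\<close> in quantitative form: one constant
  for all \<open>t\<close>.\<close>

definition coercive :: "nat set \<Rightarrow> real mat \<Rightarrow> bool" where
  "coercive J x \<longleftrightarrow> (\<exists>c>0. \<forall>t. quad J x t \<le> - c * sqn J t)"

lemma component_measurable:
  "j \<in> J \<Longrightarrow> (\<lambda>t. t j) \<in> borel_measurable (\<Pi>\<^sub>M j\<in>J. (lborel :: real measure))"
  using measurable_component_singleton[of j J "\<lambda>_. lborel :: real measure"] by simp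

lemma hJ_measurable:
  "hJ J x y \<in> borel_measurable (\<Pi>\<^sub>M j\<in>J. lborel)"
  unfolding hJ_def by (intro borel_measurable_sum borel_intros component_measurable)

text \<open>Half of the quadratic decay absorbs the linear term, by completing the square in each
  coordinate; the leftover constants add up to \<open>C\<close>.\<close>

lemma dominated_exp_hJ:
  assumes "finite J" "coercive J x"
  shows "dominated J (\<lambda>t. exp (hJ J x y t))"
proof -
  obtain c where c: "c > 0" "\<And>t. quad J x t \<le> - c * sqn J t"
    using assms(2) unfolding coercive_def by blast
  define C where "C = (\<Sum>k\<in>J. (y $ k)\<^sup>2 / (2 * c))"
  have "\<bar>exp (hJ J x y t)\<bar> \<le> exp C * exp (- (c / 2) * sqn J t)" for t
  proof -
    have "y $ k * t k \<le> (y $ k)\<^sup>2 / (2 * c) + c / 2 * (t k)\<^sup>2" for k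
    proof -
      have "0 \<le> (y $ k - c * t k)\<^sup>2 / (2 * c)" using c by simp
      also have "\<dots> = (y $ k)\<^sup>2 / (2 * c) + c / 2 * (t k)\<^sup>2 - y $ k * t k"
        using c by (simp add: field_simps power2_eq_square)
      finally show ?thesis by simp
    qed
    hence "(\<Sum>k\<in>J. y $ k * t k) \<le> (\<Sum>k\<in>J. (y $ k)\<^sup>2 / (2 * c) + c / 2 * (t k)\<^sup>2)"
      by (intro sum_mono) auto
    also have "\<dots> = C + c / 2 * sqn J t"
      by (simp add: C_def sqn_def sum.distrib sum_distrib_left)
    finally have "hJ J x y t \<le> C + (- (c / 2) * sqn J t)"
      using c(2)[of t] by (simp add: hJ_def quad_def)
    thus ?thesis by (simp flip: exp_add)
  qed
  moreover have "c / 2 > 0" using c by simp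
  ultimately show ?thesis
    unfolding dominated_def by (blast intro: borel_measurable_exp_comp hJ_measurable)
qed

text \<open>Arithmetic-geometric mean inequality. Bounding each square by the whole sum, at the
  price of a factor 2, treats \<open>i = j\<close> and \<open>i \<noteq> j\<close> alike.\<close>

lemma prod_le_sqn:
  assumes "finite J" "i \<in> J" "j \<in> J"
  shows "\<bar>t i * t j\<bar> \<le> sqn J t"
proof -
  have "(t k)\<^sup>2 \<le> sqn J t" if "k \<in> J" for k
    unfolding sqn_def using assms(1) that by (intro member_le_sum) auto
  from this[OF assms(2)] this[OF assms(3)]
  have "(t i)\<^sup>2 + (t j)\<^sup>2 \<le> 2 * sqn J t" by simp
  moreover have "0 \<le> (\<bar>t i\<bar> - \<bar>t j\<bar>)\<^sup>2" by simp
  ultimately show ?thesis by (simp add: power2_diff abs_mult)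
qed

text \<open>Puts linear factors under the growth bound \<open>L * (1 + sqn J t)\<close>; the 1 is
  there because a linear function exceeds its square near 0.\<close>

lemma component_le_sqn:
  assumes "finite J" "j \<in> J"
  shows "\<bar>t j\<bar> \<le> 1 + sqn J t"
proof -
  have "0 \<le> (\<bar>t j\<bar> - 1)\<^sup>2" by simp
  hence "\<bar>t j\<bar> \<le> 1 + \<bar>t j * t j\<bar>" by (simp add: power2_diff abs_mult) (simp add: power2_eq_square)
  with prod_le_sqn[OF assms assms(2), of t] show ?thesis by simp
qed

lemma dominated_component:
  assumes "finite J" "j \<in> J" "dominated J w"
  shows "dominated J (\<lambda>t. w t * t j)"
  using component_le_sqn[OF assms(1,2)]
  by (intro dominated_mult[OF assms(3) component_measurable[OF assms(2)], of 1]) auto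

text \<open>The integrand is the derivative of
  \<open>exp (\<alpha> * s\<^sup>2 + \<beta> * s + \<gamma>)\<close>, which is
  \<open>exp \<gamma>\<close> at 0 and tends to 0 at infinity. Its integrability is that of a first
  central moment of a normal density.\<close>

lemma gaussian_FTC:
  fixes \<alpha> \<beta> \<gamma> :: real
  assumes "\<alpha> < 0"
  shows "(LINT s : {0..} | lborel. (2 * \<alpha> * s + \<beta>) * exp (\<alpha> * s\<^sup>2 + \<beta> * s + \<gamma>)) = - exp \<gamma>"
proof -
  let ?f = "\<lambda>s. (2 * \<alpha> * s + \<beta>) * exp (\<alpha> * s\<^sup>2 + \<beta> * s + \<gamma>)"
  let ?F = "\<lambda>s. exp (\<alpha> * s\<^sup>2 + \<beta> * s + \<gamma>)"
  \<comment> \<open>Mean and standard deviation of the normal density, read off by completing the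
    square; \<open>C\<close> below collects the remaining constants.\<close>
  define \<mu> where "\<mu> = - \<beta> / (2 * \<alpha>)"
  define \<sigma> where "\<sigma> = 1 / sqrt (- 2 * \<alpha>)"
  have \<sigma>: "\<sigma> > 0" "\<sigma>\<^sup>2 = - 1 / (2 * \<alpha>)"
    using assms by (auto simp: \<sigma>_def power_divide)
  have sq: "\<alpha> * s\<^sup>2 + \<beta> * s + \<gamma> = \<alpha> * (s - \<mu>)\<^sup>2 + (\<gamma> - \<alpha> * \<mu>\<^sup>2)" for s
    using assms by (simp add: \<mu>_def power2_eq_square field_simps)
  have lin: "2 * \<alpha> * s + \<beta> = 2 * \<alpha> * (s - \<mu>)" for s
    using assms by (simp add: \<mu>_def field_simps)
  define C where "C = 2 * \<alpha> * exp (\<gamma> - \<alpha> * \<mu>\<^sup>2) * sqrt (2 * pi * \<sigma>\<^sup>2)"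
  have "?f = (\<lambda>s. C * (normal_density \<mu> \<sigma> s * (s - \<mu>) ^ 1))"
  proof
    fix s
    have e: "- (s - \<mu>)\<^sup>2 / (2 * \<sigma>\<^sup>2) = \<alpha> * (s - \<mu>)\<^sup>2"
      using assms by (simp add: \<sigma>(2) field_simps)
    have "?f s = 2 * \<alpha> * (s - \<mu>) * exp (\<alpha> * (s - \<mu>)\<^sup>2) * exp (\<gamma> - \<alpha> * \<mu>\<^sup>2)"
      unfolding sq lin by (simp add: exp_add)
    also have "\<dots> = C * (normal_density \<mu> \<sigma> s * (s - \<mu>) ^ 1)"
      unfolding C_def normal_density_def e using \<sigma>(1) by simp
    finally show "?f s = C * (normal_density \<mu> \<sigma> s * (s - \<mu>) ^ 1)" .
  qed
  hence int: "integrable lborel ?f"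
    using integrable_mult_right[OF integrable_normal_moment[OF \<sigma>(1), of \<mu> 1], of C] by simp
  have "(LBINT s=0..\<infinity>. ?f s) = 0 - ?F 0"
  proof (rule interval_integral_FTC_integrable)
    show "(?F has_vector_derivative ?f s) (at s)" for s
      unfolding has_real_derivative_iff_has_vector_derivative[symmetric]
      by (auto intro!: derivative_eq_intros simp: algebra_simps)
    show "set_integrable lborel (einterval 0 \<infinity>) ?f"
      using integrable_mult_indicator[OF _ int, of "einterval 0 \<infinity>"] by (simp add: set_integrable_def)
    have "(?F \<longlongrightarrow> ?F 0) (at_right 0)" by (intro tendsto_intros)
    thus "((?F \<circ> real_of_ereal) \<longlongrightarrow> ?F 0) (at_right 0)"
      unfolding zero_ereal_def by (simp add: ereal_tendsto_simps o_assoc)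
    have "(?F \<longlongrightarrow> 0) at_top" using assms by real_asymp
    thus "((?F \<circ> real_of_ereal) \<longlongrightarrow> 0) (at_left \<infinity>)"
      by (simp add: ereal_tendsto_simps)
  qed (auto intro!: continuous_intros)
  moreover have "(LBINT s=0..\<infinity>. ?f s) = (LINT s : {0<..} | lborel. ?f s)"
    by (simp add: interval_integral_to_infinity_eq zero_ereal_def)
  \<comment> \<open>The interval integral runs over the open half-line, which differs from the
    closed one by a null set.\<close>
  moreover have "\<dots> = (LINT s : {0..} | lborel. ?f s)"
    unfolding set_lebesgue_integral_def
    by (rule integral_discrete_difference[of "{0}"]) (auto simp: indicator_def)
  ultimately show ?thesis by simp
qed

text \<open>Isolates one coordinate for Fubini. By symmetry row \<open>j\<close> and column
  \<open>j\<close> give equal cross terms, hence the factor 2.\<close>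

lemma quad_insert:
  assumes "finite I" "j \<notin> I" and sym: "\<And>i. i \<in> I \<Longrightarrow> x $$ (i, j) = x $$ (j, i)"
  shows "quad (insert j I) x (t(j := s)) =
    x $$ (j, j) * s\<^sup>2 + 2 * s * (\<Sum>k\<in>I. x $$ (j, k) * t k) + quad I x t"
proof -
  have ne: "i \<in> I \<Longrightarrow> i \<noteq> j" for i using assms(2) by auto
  have "quad (insert j I) x (t(j := s)) = x $$ (j, j) * s\<^sup>2 + (\<Sum>k\<in>I. x $$ (j, k) * s * t k)
      + ((\<Sum>k\<in>I. x $$ (k, j) * t k * s) + quad I x t)"
    unfolding quad_def using assms(1,2) ne
    by (simp add: sum.distrib power2_eq_square cong: sum.cong)
  also have "(\<Sum>k\<in>I. x $$ (k, j) * t k * s) = (\<Sum>k\<in>I. x $$ (j, k) * s * t k)"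
    by (intro sum.cong) (auto simp: sym)
  finally show ?thesis
    by (simp add: sum_distrib_left sum_distrib_right algebra_simps del: fun_upd_apply)
qed

lemma hJ_insert:
  assumes "finite I" "j \<notin> I" and "\<And>i. i \<in> I \<Longrightarrow> x $$ (i, j) = x $$ (j, i)"
  shows "hJ (insert j I) x y (t(j := s)) =
    x $$ (j, j) * s\<^sup>2 + (2 * (\<Sum>k\<in>I. x $$ (j, k) * t k) + y $ j) * s + hJ I x y t"
proof -
  have "(\<Sum>k\<in>insert j I. y $ k * (t(j := s)) k) = y $ j * s + (\<Sum>k\<in>I. y $ k * t k)"
    using assms(1,2) by (auto intro!: sum.cong)
  thus ?thesis
    using quad_insert[of I j x t s] assms by (simp add: hJ_def quad_def algebra_simps)
qed

text \<open>Coercivity tested on a unit vector; this supplies the negative leading coefficient for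
  \<open>gaussian_FTC\<close>.\<close>

lemma coercive_diag_neg:
  assumes "finite J" "coercive J x" "j \<in> J"
  shows "x $$ (j, j) < 0"
proof -
  obtain c where c: "c > 0" "\<And>t. quad J x t \<le> - c * sqn J t"
    using assms(2) unfolding coercive_def by blast
  let ?t = "\<lambda>k. if k = j then 1 else 0 :: real"
  have "quad J x ?t = (\<Sum>i\<in>J. if i = j then x $$ (i, j) else 0)" "sqn J ?t = 1"
    using assms(1,3) unfolding quad_def sqn_def
    by (auto simp: if_distrib[of "\<lambda>u. _ * u"] if_distrib[of "\<lambda>u. u\<^sup>2"] cong: if_cong intro!: sum.cong)
  with c(2)[of ?t] c(1) assms(1,3) show ?thesis by simp
qed

text \<open>The left side is the orthant integral of \<open>\<partial>/\<partial>t j\<close> of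
  \<open>exp (hJ J x y t)\<close>, expanded by linearity. Fubini with \<open>t j\<close> innermost
  reduces it to \<open>gaussian_FTC\<close>, whose boundary value at \<open>t j = 0\<close> is the
  integrand for \<open>J - {j}\<close>.\<close>

lemma integration_by_parts:
  assumes J: "finite J" "coercive J x" "j \<in> J"
    and sym: "\<And>i k. i \<in> J \<Longrightarrow> k \<in> J \<Longrightarrow> x $$ (i, k) = x $$ (k, i)"
  shows "2 * (\<Sum>k\<in>J. x $$ (j, k) * orthant_int J (\<lambda>t. exp (hJ J x y t) * t k)) + y $ j * gJ J x y
    = - gJ (J - {j}) x y"
proof -
  define I where "I = J - {j}"
  have I: "finite I" "j \<notin> I" "J = insert j I" using J by (auto simp: I_def)
  let ?M = "\<lambda>J. \<Pi>\<^sub>M j\<in>J. (lborel :: real measure)"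
  let ?P = "\<lambda>J. \<Pi>\<^sub>E j\<in>J. {0::real..}"
  let ?e = "\<lambda>t. exp (hJ J x y t)"
  \<comment> \<open>The derivative of the exponent with respect to \<open>t j\<close>, using the
    symmetry of \<open>x\<close>.\<close>
  let ?b = "\<lambda>t. 2 * (\<Sum>k\<in>J. x $$ (j, k) * t k) + y $ j"
  note dom = dominated_exp_hJ[OF J(1,2), of y]
  have int: "set_integrable (?M J) (?P J) v" if "dominated J v" for v
    using dominated_set_integrable[OF J(1) that orthant_sets[OF J(1)]] .
  have eq: "?e t * ?b t = (\<Sum>k\<in>J. 2 * x $$ (j, k) * (?e t * t k)) + y $ j * ?e t" for t
    by (simp add: algebra_simps sum_distrib_left)
  have ints: "set_integrable (?M J) (?P J) (\<lambda>t. ?e t * t k)" if "k \<in> J" for k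
    by (intro int dominated_component J(1) that dom)
  have ints': "set_integrable (?M J) (?P J) (\<lambda>t. \<Sum>k\<in>J. 2 * x $$ (j, k) * (?e t * t k))"
    using ints J(1) unfolding set_integrable_def
    by (simp add: sum_distrib_left mult.left_commute[of "indicator _ _"])
  have inte: "set_integrable (?M J) (?P J) (\<lambda>t. ?e t * ?b t)"
    unfolding eq using ints' int[OF dom] by (intro set_integral_add) auto
  have "orthant_int J (\<lambda>t. ?e t * ?b t) = orthant_int J (\<lambda>t. \<Sum>k\<in>J. 2 * x $$ (j, k) * (?e t * t k))
      + orthant_int J (\<lambda>t. y $ j * ?e t)"
    unfolding eq using ints' int[OF dom] by (intro set_integral_add) auto
  also have "orthant_int J (\<lambda>t. \<Sum>k\<in>J. 2 * x $$ (j, k) * (?e t * t k))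
      = (\<Sum>k\<in>J. orthant_int J (\<lambda>t. 2 * x $$ (j, k) * (?e t * t k)))"
    using ints unfolding set_integrable_def set_lebesgue_integral_def
    by (subst Bochner_Integration.integral_sum[symmetric])
      (auto simp: sum_distrib_left mult.left_commute[of "indicator _ _"])
  finally have lhs: "orthant_int J (\<lambda>t. ?e t * ?b t) =
      2 * (\<Sum>k\<in>J. x $$ (j, k) * orthant_int J (\<lambda>t. ?e t * t k)) + y $ j * gJ J x y"
    by (simp add: gJ_def sum_distrib_left mult.assoc)
  have "orthant_int J (\<lambda>t. ?e t * ?b t) = (LINT t | ?M (insert j I). indicator (?P J) t *\<^sub>R (?e t * ?b t))"
    by (simp add: set_lebesgue_integral_def I(3))
  also have "\<dots> = (LINT t | ?M I. LINT s | lborel. indicator (?P J) (t(j := s)) *\<^sub>R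
      (?e (t(j := s)) * ?b (t(j := s))))"
    using inte unfolding set_integrable_def I(3) by (intro lb.product_integral_insert I(1,2))
  also have "\<dots> = (LINT t | ?M I. indicator (?P I) t *\<^sub>R (- exp (hJ I x y t)))"
  proof (rule Bochner_Integration.integral_cong[OF refl])
    fix t assume "t \<in> space (?M I)"
    hence ext: "t \<in> extensional I" by (simp add: space_PiM PiE_def)
    let ?\<beta> = "2 * (\<Sum>k\<in>I. x $$ (j, k) * t k) + y $ j"
    \<comment> \<open>Membership in an extensional product also fixes the values outside the index
      set; \<open>ext\<close> provides these for \<open>t\<close>, so the indicator factors.\<close>
    have ind: "indicator (?P J) (t(j := s)) = (indicator (?P I) t * indicator {0..} s :: real)" for s
    proof -
      have "t(j := s) \<in> ?P J \<longleftrightarrow> t \<in> ?P I \<and> s \<in> {0..}"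
        using ext I(2) unfolding I(3) by (auto simp: PiE_iff extensional_def split: if_splits)
      thus ?thesis by (simp add: indicator_def)
    qed
    have hh: "hJ J x y (t(j := s)) = x $$ (j, j) * s\<^sup>2 + ?\<beta> * s + hJ I x y t" for s
      unfolding I(3) by (rule hJ_insert[OF I(1,2)]) (use sym I(3) in auto)
    have bb: "?b (t(j := s)) = 2 * x $$ (j, j) * s + ?\<beta>" for s
    proof -
      have "(\<Sum>k\<in>I. x $$ (j, k) * (t(j := s)) k) = (\<Sum>k\<in>I. x $$ (j, k) * t k)"
        using I(2) by (intro sum.cong) auto
      thus ?thesis unfolding I(3) using I(1,2) by (simp add: algebra_simps)
    qed
    have "(LINT s | lborel. indicator (?P J) (t(j := s)) *\<^sub>R (?e (t(j := s)) * ?b (t(j := s))))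
      = (LINT s | lborel. indicator (?P I) t * (indicator {0..} s *
          ((2 * x $$ (j, j) * s + ?\<beta>) * exp (x $$ (j, j) * s\<^sup>2 + ?\<beta> * s + hJ I x y t))))"
      unfolding ind hh bb by (simp add: mult_ac)
    also have "\<dots> = indicator (?P I) t * (LINT s : {0..} | lborel.
          ((2 * x $$ (j, j) * s + ?\<beta>) * exp (x $$ (j, j) * s\<^sup>2 + ?\<beta> * s + hJ I x y t)))"
      by (simp add: set_lebesgue_integral_def)
    also have "\<dots> = indicator (?P I) t *\<^sub>R (- exp (hJ I x y t))"
      using gaussian_FTC[OF coercive_diag_neg[OF J]] by simp
    finally show "(LINT s | lborel. indicator (?P J) (t(j := s)) *\<^sub>R (?e (t(j := s)) * ?b (t(j := s))))
      = indicator (?P I) t *\<^sub>R (- exp (hJ I x y t))" .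
  qed
  also have "\<dots> = - gJ I x y" by (simp add: gJ_def set_lebesgue_integral_def)
  finally show ?thesis unfolding lhs I_def .
qed

subsection \<open>Coercivity and the inverse of the submatrix\<close>

text \<open>The form attains its maximum on the compact unit sphere of functions vanishing outside
  \<open>J\<close>. That maximum is negative, and homogeneity of degree 2 carries it to all
  \<open>t\<close>.\<close>

lemma coercive_if_neg_definite:
  assumes J: "finite J"
    and neg: "\<And>t. (\<exists>j\<in>J. t j \<noteq> 0) \<Longrightarrow> quad J x t < 0"
  shows "coercive J x"
proof (cases "J = {}")
  case True
  thus ?thesis unfolding coercive_def quad_def sqn_def by (auto intro!: exI[of _ 1])
next
  case False
  then obtain j0 where j0: "j0 \<in> J" by blast
  \<comment> \<open>Pinning the coordinates outside \<open>J\<close> to 0 makes \<open>K\<close> a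
    product of compact sets, so Tychonoff applies; on \<open>J\<close> the bounds follow from
    \<open>sqn J t = 1\<close>.\<close>
  define K where "K = (\<Pi>\<^sub>E j\<in>UNIV. if j \<in> J then {-1..1::real} else {0})"
  define S where "S = K \<inter> {t. sqn J t = 1}"
  have cont: "continuous_on UNIV (\<lambda>t::nat \<Rightarrow> real. t j)" for j
    by (rule continuous_on_product_coordinates)
  have contq: "continuous_on UNIV (quad J x)" unfolding quad_def
    by (intro continuous_intros cont)
  have conts: "continuous_on UNIV (sqn J)" unfolding sqn_def
    by (intro continuous_intros cont)
  have "compact K" unfolding K_def
    by (subst compactin_euclidean_iff[symmetric], subst euclidean_product_topology[symmetric],
        subst compactin_PiE) auto
  moreover have "closed {t. sqn J t = 1}"
    using conts by (intro closed_Collect_eq) auto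
  ultimately have "compact S" unfolding S_def by (rule compact_Int_closed)
  moreover have "S \<noteq> {}"
  proof -
    have "(\<lambda>k. if k = j0 then 1 else 0) \<in> S"
      using j0 J by (auto simp: S_def K_def sqn_def if_distrib[of "\<lambda>u. u\<^sup>2"] cong: if_cong)
    thus ?thesis by blast
  qed
  ultimately obtain t0 where t0: "t0 \<in> S" "\<And>t. t \<in> S \<Longrightarrow> quad J x t \<le> quad J x t0"
    using continuous_attains_sup[of S "quad J x"] continuous_on_subset[OF contq] by blast
  define c where "c = - quad J x t0"
  have "\<exists>j\<in>J. t0 j \<noteq> 0"
  proof (rule ccontr)
    assume "\<not> ?thesis"
    hence "sqn J t0 = 0" by (simp add: sqn_def)
    with t0(1) show False by (simp add: S_def)
  qed
  hence "c > 0" using neg unfolding c_def by simp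
  moreover have "quad J x t \<le> - c * sqn J t" for t
  proof (cases "sqn J t = 0")
    case True
    hence "\<And>j. j \<in> J \<Longrightarrow> t j = 0" using J by (simp add: sqn_def sum_nonneg_eq_0_iff)
    thus ?thesis using True by (simp add: quad_def)
  next
    case False
    define r where "r = sqrt (sqn J t)"
    have r: "r > 0" "r\<^sup>2 = sqn J t" using False sqn_nonneg[of J t] by (auto simp: r_def)
    \<comment> \<open>Normalised to the sphere and cut off outside \<open>J\<close>, which neither
      \<open>quad J x\<close> nor \<open>sqn J\<close> can see.\<close>
    define u where "u = (\<lambda>j. if j \<in> J then t j / r else 0)"
    have q: "quad J x t = r\<^sup>2 * quad J x u"
      unfolding quad_def sum_distrib_left
      using r(1) by (intro sum.cong refl) (simp add: u_def field_simps power2_eq_square)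
    have "sqn J u = sqn J t / r\<^sup>2"
      unfolding sqn_def sum_divide_distrib
      by (intro sum.cong refl) (simp add: u_def power_divide)
    hence su: "sqn J u = 1" using r False by simp
    have "\<bar>u j\<bar> \<le> 1" if "j \<in> J" for j
      using prod_le_sqn[OF J that that, of u] su
      by (metis abs_mult_self_eq abs_of_nonneg abs_square_le_1 power2_eq_square zero_le_square)
    moreover have "u j = 0" if "j \<notin> J" for j using that by (simp add: u_def)
    ultimately have "u \<in> S" using su by (auto simp: S_def K_def abs_le_iff minus_le_iff)
    from t0(2)[OF this] have "r\<^sup>2 * quad J x u \<le> r\<^sup>2 * (- c)"
      unfolding c_def by (intro mult_left_mono) auto
    thus ?thesis unfolding q by (simp add: r(2) mult.commute)
  qed
  ultimately show ?thesis unfolding coercive_def by blast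
qed

text \<open>Extending \<open>t\<close> by zero from \<open>J\<close> to all indices turns the form
  on \<open>J\<close> into the full form of \<open>x\<close>.\<close>

lemma coercive_if_positive_definite:
  assumes x: "x \<in> carrier_mat d d" and pd: "positive_definite_mat (- x)" and J: "J \<subseteq> {..<d}"
  shows "coercive J x"
proof (rule coercive_if_neg_definite)
  show fin: "finite J" using J finite_subset by blast
  fix t :: "nat \<Rightarrow> real" assume "\<exists>j\<in>J. t j \<noteq> 0"
  then obtain j where j: "j \<in> J" "t j \<noteq> 0" by blast
  define u where "u = (\<lambda>j. if j \<in> J then t j else 0)"
  define v where "v = vec d u"
  have v: "v \<in> carrier_vec d" by (simp add: v_def)
  have "v $ j \<noteq> 0" "j < d" using j J by (auto simp: v_def u_def)
  hence "v \<noteq> 0\<^sub>v d" by auto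
  hence "0 < v \<bullet> ((- x) *\<^sub>v v)" using pd x v unfolding positive_definite_mat_def by auto
  also have "v \<bullet> ((- x) *\<^sub>v v) = - quad {..<d} x u"
    using x by (simp add: v_def scalar_prod_def quad_def sum_distrib_left mult_ac
        lessThan_atLeast0 flip: sum_negf)
  also have "quad {..<d} x u = (\<Sum>i\<in>J. \<Sum>j\<in>{..<d}. x $$ (i, j) * u i * u j)"
    unfolding quad_def using J by (intro sum.mono_neutral_right) (auto simp: u_def)
  also have "\<dots> = quad J x u"
    unfolding quad_def using J by (intro sum.cong refl sum.mono_neutral_right) (auto simp: u_def)
  also have "\<dots> = quad J x t" unfolding quad_def u_def by (intro sum.cong) auto
  finally show "quad J x t < 0" by simp
qed

section \<open>Elements of \<open>J\<close>, positions in the submatrix, and its inverse\<close>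

lemma bij_posn:
  assumes "finite J"
  shows "bij_betw (posn J) J {..<card J}"
proof -
  have "inj_on (posn J) J"
    by (rule inj_on_inverseI[of _ "pick J"]) (simp add: posn_def pick_card_in_set)
  moreover have "posn J ` J \<subseteq> {..<card J}"
    using assms by (auto simp: posn_def intro!: psubset_card_mono)
  ultimately show ?thesis
    using assms by (simp add: bij_betw_def card_image card_subset_eq)
qed

lemma pick_posn: "j \<in> J \<Longrightarrow> pick J (posn J j) = j"
  by (simp add: posn_def pick_card_in_set)

lemma posn_less: "finite J \<Longrightarrow> j \<in> J \<Longrightarrow> posn J j < card J"
  using bij_betwE[OF bij_posn] by blast

lemma submatrix_carrier:
  assumes "x \<in> carrier_mat d d" "J \<subseteq> {..<d}"
  shows "submatrix x J J \<in> carrier_mat (card J) (card J)"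
proof -
  have "{i. i < d \<and> i \<in> J} = J" using assms(2) by auto
  hence "card {i. i < d \<and> i \<in> J} = card J" by (rule arg_cong)
  thus ?thesis using assms(1) by (intro carrier_matI) (simp_all only: dim_submatrix carrier_matD)
qed

lemma submatrix_posn:
  assumes "x \<in> carrier_mat d d" "J \<subseteq> {..<d}" "i \<in> J" "j \<in> J"
  shows "submatrix x J J $$ (posn J i, posn J j) = x $$ (i, j)"
  unfolding posn_def using assms by (intro submatrix_index_card) auto

text \<open>A kernel vector of the submatrix, carried over to \<open>J\<close>, would be a zero of
  the form, which coercivity allows only for the zero vector. Hence \<open>the\<close> in
  \<open>SigmaJ\<close> is applied to a genuine inverse.\<close>

lemma mat_inverse_submatrix:
  assumes x: "x \<in> carrier_mat d d" and J: "J \<subseteq> {..<d}" and co: "coercive J x"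
  obtains B where "mat_inverse (submatrix x J J) = Some B" "B \<in> carrier_mat (card J) (card J)"
    "B * submatrix x J J = 1\<^sub>m (card J)"
proof -
  have fin: "finite J" using J finite_subset by blast
  define m where "m = card J"
  define A where "A = submatrix x J J"
  have A: "A \<in> carrier_mat m m" unfolding A_def m_def by (rule submatrix_carrier[OF x J])
  note bij = bij_posn[OF fin, folded m_def]
  obtain c where c: "c > 0" "\<And>t. quad J x t \<le> - c * sqn J t"
    using co unfolding coercive_def by blast
  have "Determinant.det A \<noteq> 0"
  proof
    assume "Determinant.det A = 0"
    then obtain v where v: "v \<in> carrier_vec m" "v \<noteq> 0\<^sub>v m" "A *\<^sub>v v = 0\<^sub>v m"
      using det_0_iff_vec_prod_zero_field[OF A] by blast
    define t where "t = (\<lambda>j. v $ posn J j)"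
    have "(\<Sum>j\<in>J. x $$ (i, j) * t j) = 0" if "i \<in> J" for i
    proof -
      have "(\<Sum>j\<in>J. x $$ (i, j) * t j) = (\<Sum>j\<in>J. A $$ (posn J i, posn J j) * v $ posn J j)"
        unfolding A_def t_def by (intro sum.cong refl) (simp add: submatrix_posn[OF x J that])
      also have "\<dots> = (\<Sum>b<m. A $$ (posn J i, b) * v $ b)"
        by (rule sum.reindex_bij_betw[OF bij])
      also have "\<dots> = (A *\<^sub>v v) $ posn J i"
        using A v(1) posn_less[OF fin that] by (simp add: scalar_prod_def m_def lessThan_atLeast0)
      finally show ?thesis using v(3) posn_less[OF fin that] by (simp add: m_def)
    qed
    hence "quad J x t = 0"
      unfolding quad_def by (simp add: mult.commute[of _ "t _"] mult.left_commute mult.assoc flip: sum_distrib_left)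
    with c have "sqn J t = 0" using sqn_nonneg[of J t]
      by (smt (verit) mult_pos_pos mult_minus_left)
    hence "\<And>j. j \<in> J \<Longrightarrow> t j = 0" using fin by (simp add: sqn_def sum_nonneg_eq_0_iff)
    hence "v $ b = 0" if "b < m" for b
      using bij that unfolding t_def bij_betw_def by (metis imageE lessThan_iff)
    hence "v = 0\<^sub>v m" using v(1) by auto
    with v(2) show False by simp
  qed
  from det_non_zero_imp_unit[OF A this, of "()"] have "mat_inverse A \<noteq> None"
    using mat_inverse(1)[OF A, of "()"] by blast
  then obtain B where B: "mat_inverse A = Some B" by blast
  from mat_inverse(2)[OF A B] B that show ?thesis by (simp add: A_def m_def)
qed

text \<open>\<open>SigmaJ\<close> is a left inverse of \<open>-2\<close> times the submatrix,
  written over elements of \<open>J\<close> so that it can be multiplied into the linear system for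
  the first moments.\<close>

lemma sigma_entry_inverse:
  assumes x: "x \<in> carrier_mat d d" and J: "J \<subseteq> {..<d}" and co: "coercive J x"
    and ik: "i \<in> J" "k \<in> J"
  shows "(\<Sum>j\<in>J. sigma_entry J x i j * (-2 * x $$ (j, k))) = (if i = k then 1 else 0)"
proof -
  have fin: "finite J" using J finite_subset by blast
  define m where "m = card J"
  define A where "A = submatrix x J J"
  have A: "A \<in> carrier_mat m m" unfolding A_def m_def by (rule submatrix_carrier[OF x J])
  note bij = bij_posn[OF fin, folded m_def]
  obtain B where B: "mat_inverse A = Some B" and BA: "B \<in> carrier_mat m m" "B * A = 1\<^sub>m m"
    using mat_inverse_submatrix[OF x J co] unfolding A_def m_def by blast
  have sig: "sigma_entry J x i j = - 1 / 2 * B $$ (posn J i, posn J j)" if "i \<in> J" "j \<in> J" for i j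
    using BA posn_less[OF fin] that B
    by (simp add: sigma_entry_def SigmaJ_def A_def m_def)
  have "(\<Sum>j\<in>J. sigma_entry J x i j * (-2 * x $$ (j, k)))
      = (\<Sum>j\<in>J. B $$ (posn J i, posn J j) * A $$ (posn J j, posn J k))"
    unfolding A_def by (intro sum.cong refl) (simp add: sig ik submatrix_posn[OF x J])
  also have "\<dots> = (\<Sum>b<m. B $$ (posn J i, b) * A $$ (b, posn J k))"
    by (rule sum.reindex_bij_betw[OF bij])
  also have "\<dots> = (B * A) $$ (posn J i, posn J k)"
    using A BA(1) posn_less[OF fin] ik by (simp add: scalar_prod_def m_def lessThan_atLeast0)
  also have "\<dots> = (if i = k then 1 else 0)"
    using BA posn_less[OF fin] ik bij_posn[OF fin]
    by (auto simp: m_def bij_betw_def inj_on_eq_iff)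
  finally show ?thesis .
qed

lemma mu_entry_sum:
  assumes x: "x \<in> carrier_mat d d" and J: "J \<subseteq> {..<d}" and co: "coercive J x" and i: "i \<in> J"
  shows "mu_entry J x y i = (\<Sum>j\<in>J. sigma_entry J x i j * y $ j)"
proof -
  have fin: "finite J" using J finite_subset by blast
  obtain B where B: "mat_inverse (submatrix x J J) = Some B" "B \<in> carrier_mat (card J) (card J)"
    using mat_inverse_submatrix[OF x J co] by blast
  hence S: "SigmaJ J x \<in> carrier_mat (card J) (card J)" by (simp add: SigmaJ_def)
  have "mu_entry J x y i = (\<Sum>b<card J. SigmaJ J x $$ (posn J i, b) * y $ pick J b)"
    using S posn_less[OF fin i]
    by (simp add: mu_entry_def muJ_def subvec_def scalar_prod_def lessThan_atLeast0)
  also have "\<dots> = (\<Sum>j\<in>J. SigmaJ J x $$ (posn J i, posn J j) * y $ pick J (posn J j))"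
    by (rule sum.reindex_bij_betw[OF bij_posn[OF fin], symmetric])
  also have "\<dots> = (\<Sum>j\<in>J. sigma_entry J x i j * y $ j)"
    by (intro sum.cong refl) (simp only: sigma_entry_def pick_posn)
  finally show ?thesis .
qed

subsection \<open>Partial derivatives\<close>

text \<open>\<open>hJ\<close> is affine in \<open>y $ i\<close>, so moving that coordinate
  multiplies the integrand by an exponential, the shape that
  \<open>orthant_int_has_derivative\<close> expects.\<close>

lemma hJ_update_y:
  assumes "finite J" "J \<subseteq> {..<dim_vec y}"
  shows "hJ J x (y |\<^sub>v i \<mapsto> s) t = hJ J x y t + (s - y $ i) * (if i \<in> J then t i else 0)"
proof -
  have "(y |\<^sub>v i \<mapsto> s) $ k * t k = y $ k * t k + (if k = i then (s - y $ i) * t i else 0)"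
    if "k \<in> J" for k
    using that assms(2) by (cases "k = i") (auto simp: algebra_simps)
  hence "(\<Sum>k\<in>J. (y |\<^sub>v i \<mapsto> s) $ k * t k) = (\<Sum>k\<in>J. y $ k * t k) +
      (\<Sum>k\<in>J. if k = i then (s - y $ i) * t i else 0)"
    by (simp add: sum.distrib)
  thus ?thesis using assms(1) by (simp add: hJ_def)
qed

text \<open>The weight \<open>v\<close> makes one lemma serve both orders: \<open>v = 1\<close> for
  the first derivative, \<open>v = t j\<close> for the second.\<close>

lemma orthant_int_partial_y:
  assumes J: "finite J" "J \<subseteq> {..<dim_vec y}"
    and dom: "dominated J (\<lambda>t. v t * exp (hJ J x y t))"
  shows "((\<lambda>s. orthant_int J (\<lambda>t. v t * exp (hJ J x (y |\<^sub>v i \<mapsto> s) t))) has_real_derivative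
    (if i \<in> J then orthant_int J (\<lambda>t. v t * exp (hJ J x y t) * t i) else 0)) (at (y $ i))"
proof (cases "i \<in> J")
  case True
  show ?thesis
    using orthant_int_has_derivative[OF J(1) dom component_measurable[OF True], of 1 "y $ i"]
      component_le_sqn[OF J(1) True] True
    by (simp add: hJ_update_y[OF J] exp_add mult.assoc)
qed (simp add: hJ_update_y[OF J])

lemma has_partial_y_gJ:
  assumes "finite J" "J \<subseteq> {..<dim_vec y}" "coercive J x"
  shows "has_partial_y (gJ J) i x y
    (if i \<in> J then orthant_int J (\<lambda>t. exp (hJ J x y t) * t i) else 0)"
  using orthant_int_partial_y[of J y "\<lambda>_. 1" x i] assms dominated_exp_hJ[of J x y]
  by (cases "i \<in> J") (simp_all add: has_partial_y_def along_y_def gJ_def)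

lemma has_partial_yD: "has_partial_y F i x y D \<Longrightarrow> partial_y i F x y = D"
  by (simp add: has_partial_y_def partial_y_def DERIV_imp_deriv)

lemma has_partial_y_partial_y_gJ:
  assumes J: "finite J" "J \<subseteq> {..<dim_vec y}" and co: "coercive J x"
  shows "has_partial_y (partial_y j (gJ J)) i x y
    (if i \<in> J \<and> j \<in> J then orthant_int J (\<lambda>t. exp (hJ J x y t) * t j * t i) else 0)"
proof -
  \<comment> \<open>The inner derivative must be known along the whole line, not just at
    \<open>y\<close>; coercivity concerns \<open>x\<close> only, so the first-order formula holds at
    each shifted \<open>y\<close>.\<close>
  have "along_y (partial_y j (gJ J)) i x y = (\<lambda>s. if j \<in> J
      then orthant_int J (\<lambda>t. t j * exp (hJ J x (y |\<^sub>v i \<mapsto> s) t)) else 0)"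
    unfolding along_y_def
    by (intro ext, subst has_partial_yD[OF has_partial_y_gJ]) (use assms in \<open>auto simp: mult.commute\<close>)
  moreover have "dominated J (\<lambda>t. t j * exp (hJ J x y t))" if "j \<in> J"
    using dominated_component[OF J(1) that dominated_exp_hJ[OF J(1) co, of y]]
    by (simp add: mult.commute)
  ultimately show ?thesis
    using orthant_int_partial_y[OF J, of "\<lambda>t. t j" x i]
    by (cases "j \<in> J") (auto simp: has_partial_y_def mult.commute)
qed

lemma first_moment_eq:
  assumes x: "x \<in> carrier_mat d d" and J: "J \<subseteq> {..<d}" and co: "coercive J x" and i: "i \<in> J"
    and sym: "\<And>i k. i \<in> J \<Longrightarrow> k \<in> J \<Longrightarrow> x $$ (i, k) = x $$ (k, i)"
  shows "orthant_int J (\<lambda>t. exp (hJ J x y t) * t i) =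
    mu_entry J x y i * gJ J x y + (\<Sum>j\<in>J. sigma_entry J x i j * gJ (J - {j}) x y)"
proof -
  have fin: "finite J" using J finite_subset by blast
  define E where "E = (\<lambda>k. orthant_int J (\<lambda>t. exp (hJ J x y t) * t k))"
  \<comment> \<open>Row \<open>j\<close> of the linear system satisfied by the vector
    \<open>E\<close> of first moments.\<close>
  have ibp: "(\<Sum>k\<in>J. -2 * x $$ (j, k) * E k) = y $ j * gJ J x y + gJ (J - {j}) x y"
    if "j \<in> J" for j
    using integration_by_parts[OF fin co that sym, of y]
    by (simp add: E_def sum_distrib_left sum_negf mult.assoc)
  have "E i = (\<Sum>k\<in>J. if i = k then E k else 0)" using fin i by simp
  \<comment> \<open>The Kronecker delta is rewritten as \<open>SigmaJ\<close> times
    \<open>-2\<close> times the submatrix; swapping the sums then exposes the rows of the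
    system.\<close>
  also have "\<dots> = (\<Sum>k\<in>J. (\<Sum>j\<in>J. sigma_entry J x i j * (-2 * x $$ (j, k))) * E k)"
    by (intro sum.cong refl, subst sigma_entry_inverse[OF x J co i]) simp_all
  also have "\<dots> = (\<Sum>j\<in>J. sigma_entry J x i j * (\<Sum>k\<in>J. -2 * x $$ (j, k) * E k))"
    unfolding sum_distrib_left sum_distrib_right by (subst sum.swap) (simp only: mult.assoc)
  also have "\<dots> = (\<Sum>j\<in>J. sigma_entry J x i j * (y $ j * gJ J x y + gJ (J - {j}) x y))"
    by (intro sum.cong refl) (simp only: ibp)
  also have "\<dots> = mu_entry J x y i * gJ J x y + (\<Sum>j\<in>J. sigma_entry J x i j * gJ (J - {j}) x y)"
    unfolding mu_entry_sum[OF x J co i]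
    by (simp add: sum.distrib distrib_left sum_distrib_right mult.assoc)
  finally show ?thesis unfolding E_def .
qed

lemma hJ_update_x:
  assumes x: "x \<in> carrier_mat d d" and J: "J \<subseteq> {..<d}" and ij: "i < d" "j < d"
    and sym: "x $$ (j, i) = x $$ (i, j)"
  shows "hJ J (x |\<^sub>m (i, j) \<mapsto> s |\<^sub>m (j, i) \<mapsto> s) y t = hJ J x y t + (s - x $$ (i, j)) *
    (if i \<in> J \<and> j \<in> J then (if i = j then 1 else 2) * (t i * t j) else 0)"
proof -
  have fin: "finite J" using J finite_subset by blast
  let ?x = "x |\<^sub>m (i, j) \<mapsto> s |\<^sub>m (j, i) \<mapsto> s"
  let ?h = "s - x $$ (i, j)"
  \<comment> \<open>The condition \<open>i \<noteq> j\<close> in the second correction keeps a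
    diagonal entry, written twice by the update, from being counted twice. The test on
    \<open>b\<close> stands outside so that the inner sum collapses first.\<close>
  have entry: "?x $$ (a, b) * t a * t b = x $$ (a, b) * t a * t b +
      ?h * (if b = j then if a = i then t i * t j else 0 else 0) +
      ?h * (if b = i then if a = j \<and> i \<noteq> j then t i * t j else 0 else 0)"
    if "a \<in> J" "b \<in> J" for a b
    using that J x sym by (auto simp: update_mat_def algebra_simps subset_iff)
  have "quad J ?x t = quad J x t +
      ?h * (\<Sum>a\<in>J. \<Sum>b\<in>J. if b = j then if a = i then t i * t j else 0 else 0) +
      ?h * (\<Sum>a\<in>J. \<Sum>b\<in>J. if b = i then if a = j \<and> i \<noteq> j then t i * t j else 0 else 0)"
    unfolding quad_def by (simp add: entry sum.distrib sum_distrib_left cong: sum.cong)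
  also have "(\<Sum>a\<in>J. \<Sum>b\<in>J. if b = j then if a = i then t i * t j else 0 else 0) =
      (if i \<in> J \<and> j \<in> J then t i * t j else 0)"
    using fin by (cases "j \<in> J") simp_all
  also have "(\<Sum>a\<in>J. \<Sum>b\<in>J. if b = i then if a = j \<and> i \<noteq> j then t i * t j else 0 else 0) =
      (if i \<in> J \<and> j \<in> J \<and> i \<noteq> j then t i * t j else 0)"
    using fin by (cases "i = j"; cases "i \<in> J") simp_all
  finally show ?thesis
    by (auto simp: hJ_def quad_def algebra_simps)
qed

text \<open>\<open>hJ\<close> is affine in each matrix coordinate too, and an off-diagonal one moves
  two equal terms, hence the 2. The moment is written with \<open>t j * t i\<close> to agree with
  the second \<open>y\<close>-derivative.\<close>

lemma has_partial_x_gJ: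
  assumes x: "x \<in> carrier_mat d d" and J: "J \<subseteq> {..<d}" and co: "coercive J x"
    and ij: "i < d" "j < d" and sym: "x $$ (j, i) = x $$ (i, j)"
  shows "has_partial_x (gJ J) i j x y
    (if i \<in> J \<and> j \<in> J
     then (if i = j then 1 else 2) * orthant_int J (\<lambda>t. exp (hJ J x y t) * t j * t i) else 0)"
proof (cases "i \<in> J \<and> j \<in> J")
  case True
  have fin: "finite J" using J finite_subset by blast
  let ?b = "\<lambda>t. (if i = j then 1 else 2) * (t i * t j :: real)"
  have "?b \<in> borel_measurable (\<Pi>\<^sub>M j\<in>J. lborel)"
    using True by (intro borel_intros component_measurable) auto
  moreover have "\<bar>?b t\<bar> \<le> 2 * (1 + sqn J t)" for t
  proof -
    have "\<bar>t i * t j\<bar> \<le> sqn J t" using prod_le_sqn[OF fin] True by blast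
    thus ?thesis using sqn_nonneg[of J t] by (cases "i = j") (simp_all add: abs_mult)
  qed
  ultimately have "((\<lambda>s. orthant_int J (\<lambda>t. exp (hJ J x y t) * exp ((s - x $$ (i, j)) * ?b t)))
      has_real_derivative orthant_int J (\<lambda>t. exp (hJ J x y t) * ?b t)) (at (x $$ (i, j)))"
    by (rule orthant_int_has_derivative[OF fin dominated_exp_hJ[OF fin co]])
  moreover have "along_x (gJ J) i j x y =
      (\<lambda>s. orthant_int J (\<lambda>t. exp (hJ J x y t) * exp ((s - x $$ (i, j)) * ?b t)))"
    using True by (simp add: along_x_def gJ_def hJ_update_x[OF x J ij sym] exp_add)
  moreover have "orthant_int J (\<lambda>t. exp (hJ J x y t) * ?b t) =
      (if i = j then 1 else 2) * orthant_int J (\<lambda>t. exp (hJ J x y t) * t j * t i)"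
    by (simp add: mult_ac flip: set_integral_mult_right)
  ultimately show ?thesis using True by (simp only: has_partial_x_def if_True simp_thms)
next
  case False
  hence "along_x (gJ J) i j x y = (\<lambda>s. gJ J x y)"
    by (auto simp: along_x_def gJ_def hJ_update_x[OF x J ij sym])
  with False show ?thesis by (auto simp: has_partial_x_def)
qed

text \<open>\<open>partial_y\<close> rests on the total function \<open>deriv\<close>, so the
  differentiability claim certifies that the outer derivative in the second formula exists; the
  inner one is covered by the first formula at the shifted \<open>y\<close>.\<close>

theorem theorem9:
  fixes d :: nat and x :: "real mat" and y :: "real vec" and J :: "nat set"
  assumes "x \<in> carrier_mat d d" and "transpose_mat x = x"
    and "positive_definite_mat (- x)"
    and "y \<in> carrier_vec d" and "J \<subseteq> {..<d}"
  shows "(\<forall>i<d. has_partial_y (gJ J) i x y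
            (if i \<in> J then mu_entry J x y i * gJ J x y + (\<Sum>j\<in>J. sigma_entry J x i j * gJ (J - {j}) x y)
             else 0))
       \<and> (\<forall>j<d. \<forall>i\<le>j.
            along_y (partial_y j (gJ J)) i x y differentiable (at (y $ i))
          \<and> has_partial_x (gJ J) i j x y
              (if {i, j} \<subseteq> J \<and> i < j then 2 * partial_y i (partial_y j (gJ J)) x y
               else if {i} \<subseteq> J \<and> i = j then partial_y i (partial_y i (gJ J)) x y
               else 0))"
proof -
  have fin: "finite J" using assms(5) finite_subset by blast
  have dim: "J \<subseteq> {..<dim_vec y}" using assms(4,5) by simp
  note co = coercive_if_positive_definite[OF assms(1,3,5)]
  have sym: "x $$ (a, b) = x $$ (b, a)" if "a < d" "b < d" for a b
    using that assms(1) index_transpose_mat(1)[of a x b] by (simp add: assms(2))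
  note second = has_partial_y_partial_y_gJ[OF fin dim co]
  show ?thesis
  proof (intro conjI allI impI)
    fix i
    have "orthant_int J (\<lambda>t. exp (hJ J x y t) * t i) =
        mu_entry J x y i * gJ J x y + (\<Sum>j\<in>J. sigma_entry J x i j * gJ (J - {j}) x y)" if "i \<in> J"
      using assms(5) by (intro first_moment_eq[OF assms(1,5) co that] sym) auto
    with has_partial_y_gJ[OF fin dim co, of i]
    show "has_partial_y (gJ J) i x y
        (if i \<in> J then mu_entry J x y i * gJ J x y + (\<Sum>j\<in>J. sigma_entry J x i j * gJ (J - {j}) x y)
         else 0)"
      by (cases "i \<in> J") simp_all
  next
    fix i j
    show "along_y (partial_y j (gJ J)) i x y differentiable (at (y $ i))"
      using second[of j i] unfolding has_partial_y_def
      by (rule differentiableI[OF has_field_derivative_imp_has_derivative])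
  next
    fix i j assume "j < d" "i \<le> j"
    hence ij: "i < d" "j < d" by simp_all
    show "has_partial_x (gJ J) i j x y
        (if {i, j} \<subseteq> J \<and> i < j then 2 * partial_y i (partial_y j (gJ J)) x y
         else if {i} \<subseteq> J \<and> i = j then partial_y i (partial_y i (gJ J)) x y
         else 0)"
      \<comment> \<open>Both sides are the same second moment, once \<open>second\<close> evaluates
        the iterated derivative.\<close>
      using has_partial_x_gJ[OF assms(1,5) co ij sym[OF ij(2,1)], of y] \<open>i \<le> j\<close>
      by (auto simp: has_partial_yD[OF second] split: if_splits)
  qed
qed

end
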